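(* Let $\{i,j\}=\{1,2\}$. Every $i$-pseudocomplete bilocale $(L,L_1,L_2)$ is $(i,j)$-Baire.
   Context: A locale is a complete lattice $L$ with $a\wedge\bigvee B=\bigvee\{a\wedge b:b\in B\}$ for all $a\in L$, $B\subseteq L$; $\to$ is its Heyting operation. A subframe of $L$ is a subset closed under all joins and finite meets. A bilocale is a triple $(L,L_1,L_2)$ with $L_1,L_2$ subframes of a locale $L$ such that $a=\bigvee\{a_1\wedge a_2:a_1\in L_1,a_2\in L_2,a_1\wedge a_2\le a\}$ for all $a\in L$. A sublocale of $L$ is a subset $S$ closed under all meets with $x\to s\in S$ for all $x\in L$, $s\in S$; the void sublocale is $\mathsf O=\{1\}$. For $a\in L$, $\mathfrak o(a)=\{a\to x:x\in L\}$ is an open sublocale and $\mathfrak c(a)=\{x\in L:a\le x\}$ a closed sublocale. For $k\in\{1,2\}$, a sublocale is $k$-open if it equals $\mathfrak o(a)$ for some $a\in L_k$; $\mathrm{cl}_k(S)=\bigcap\{\mathfrak c(a):a\in L_k,\ S\subseteq\mathfrak c(a)\}$; $S$ is $k$-dense if $\mathrm{cl}_k(S)=L$. The bilocale is $(i,j)$-Baire if the intersection of any countably many $i$-dense $j$-open sublocales is $i$-dense. For $c\in L_i$ put $c^{\bullet}=\bigvee\{x\in L_j:x\wedge c=0\}$. The bilocale is $i$-prefit if for every nonzero $x\in L$ there is a nonzero $y\in L_i$ with $y^{\bullet}\vee x=1$. An $i$-$\pi$-base is a collection $\mathcal C$ of non-void $i$-open sublocales such that each non-void $i$-open sublocale of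 $L$ contains a member of $\mathcal C$. The bilocale is $i$-pseudocomplete if it is $i$-prefit and has a sequence $(\mathcal C_n)_{n\in\mathbb N}$ of $i$-$\pi$-bases such that whenever $\mathfrak o(x_n)\in\mathcal C_n$ and $\mathrm{cl}_j(\mathfrak o(x_{n+1}))\subseteq\mathfrak o(x_n)$ for each $n$, then $\bigcap_{n\in\mathbb N}\mathfrak o(x_n)\ne\mathsf O$. *)

theory Defs
  imports Main "HOL-Library.Countable_Set"
begin

text \<open>The library class \<open>complete_distrib_lattice\<close> asks for complete distributivity, which is
  strictly stronger than the law of a locale. The symbols \<open>0\<close> and \<open>1\<close> of a locale are \<open>bot\<close> and
  \<open>top\<close>; the locale with \<open>bot = top\<close> is not excluded.\<close>

class pointfree_locale = complete_lattice +
  assumes inf_Sup_frame: "inf a (Sup B) = Sup {inf a b | b. b \<in> B}"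

definition heyting :: "'a::pointfree_locale \<Rightarrow> 'a \<Rightarrow> 'a"  (infixr "\<rightarrow>\<^sub>H" 60) where
  "a \<rightarrow>\<^sub>H b = Sup {z. inf z a \<le> b}"

lemma le_heyting_iff: "z \<le> (a \<rightarrow>\<^sub>H b) \<longleftrightarrow> inf z a \<le> b"
proof
  assume "z \<le> (a \<rightarrow>\<^sub>H b)"
  then have "inf z a \<le> inf a (a \<rightarrow>\<^sub>H b)"
    by (simp add: le_infI1)
  also have "\<dots> \<le> b"
    unfolding heyting_def inf_Sup_frame by (auto intro!: Sup_least simp: inf_commute)
  finally show "inf z a \<le> b" .
next
  assume "inf z a \<le> b"
  then show "z \<le> (a \<rightarrow>\<^sub>H b)"
    unfolding heyting_def by (auto intro: Sup_upper)
qed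

definition subframe :: "'a::pointfree_locale set \<Rightarrow> bool" where
  "subframe M \<longleftrightarrow> (\<forall>A. A \<subseteq> M \<longrightarrow> Sup A \<in> M) \<and> (\<forall>A. A \<subseteq> M \<longrightarrow> finite A \<longrightarrow> Inf A \<in> M)"

text \<open>The locale \<open>L\<close> of a bilocale is the whole type \<open>'a\<close>, and the parts \<open>L\<^sub>1\<close> and \<open>L\<^sub>2\<close> are
  given by an indexed family \<open>P\<close>, of which only the values \<open>P 1\<close> and \<open>P 2\<close> matter.\<close>

definition bilocale :: "(nat \<Rightarrow> 'a::pointfree_locale set) \<Rightarrow> bool" where
  "bilocale P \<longleftrightarrow> subframe (P 1) \<and> subframe (P 2) \<and>
     (\<forall>a. a = Sup {inf a1 a2 | a1 a2. a1 \<in> P 1 \<and> a2 \<in> P 2 \<and> inf a1 a2 \<le> a})"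

definition is_sublocale :: "'a::pointfree_locale set \<Rightarrow> bool" where
  "is_sublocale S \<longleftrightarrow> (\<forall>A. A \<subseteq> S \<longrightarrow> Inf A \<in> S) \<and> (\<forall>x. \<forall>s\<in>S. (x \<rightarrow>\<^sub>H s) \<in> S)"

definition void_sublocale :: "'a::pointfree_locale set" where
  "void_sublocale = {top}"

definition open_sub :: "'a::pointfree_locale \<Rightarrow> 'a set" where
  "open_sub a = {a \<rightarrow>\<^sub>H x | x. True}"

definition closed_sub :: "'a::pointfree_locale \<Rightarrow> 'a set" where
  "closed_sub a = {x. a \<le> x}"

definition k_open :: "(nat \<Rightarrow> 'a::pointfree_locale set) \<Rightarrow> nat \<Rightarrow> 'a set \<Rightarrow> bool" where
  "k_open P k S \<longleftrightarrow> is_sublocale S \<and> (\<exists>a\<in>P k. S = open_sub a)"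

definition k_closure :: "(nat \<Rightarrow> 'a::pointfree_locale set) \<Rightarrow> nat \<Rightarrow> 'a set \<Rightarrow> 'a set" where
  "k_closure P k S = \<Inter> {closed_sub a | a. a \<in> P k \<and> S \<subseteq> closed_sub a}"

definition k_dense :: "(nat \<Rightarrow> 'a::pointfree_locale set) \<Rightarrow> nat \<Rightarrow> 'a set \<Rightarrow> bool" where
  "k_dense P k S \<longleftrightarrow> k_closure P k S = UNIV"

text \<open>Meets of sublocales are intersections, and the empty family is allowed: its intersection
  is \<open>UNIV\<close>, that is, \<open>L\<close>.\<close>

definition Baire :: "(nat \<Rightarrow> 'a::pointfree_locale set) \<Rightarrow> nat \<Rightarrow> nat \<Rightarrow> bool" where
  "Baire P i j \<longleftrightarrow>
     (\<forall>F. countable F \<and> (\<forall>S\<in>F. k_open P j S \<and> k_dense P i S) \<longrightarrow> k_dense P i (\<Inter> F))"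

text \<open>In the remaining notions \<open>j\<close> is the index other than \<open>i\<close>.\<close>

definition bullet :: "(nat \<Rightarrow> 'a::pointfree_locale set) \<Rightarrow> nat \<Rightarrow> 'a \<Rightarrow> 'a" where
  "bullet P j c = Sup {x \<in> P j. inf x c = bot}"

definition prefit :: "(nat \<Rightarrow> 'a::pointfree_locale set) \<Rightarrow> nat \<Rightarrow> nat \<Rightarrow> bool" where
  "prefit P i j \<longleftrightarrow> (\<forall>x. x \<noteq> bot \<longrightarrow> (\<exists>y\<in>P i. y \<noteq> bot \<and> sup (bullet P j y) x = top))"

definition pi_base :: "(nat \<Rightarrow> 'a::pointfree_locale set) \<Rightarrow> nat \<Rightarrow> 'a set set \<Rightarrow> bool" where
  "pi_base P i C \<longleftrightarrow>
     (\<forall>U\<in>C. k_open P i U \<and> U \<noteq> void_sublocale) \<and>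
     (\<forall>V. k_open P i V \<and> V \<noteq> void_sublocale \<longrightarrow> (\<exists>U\<in>C. U \<subseteq> V))"

definition pseudocomplete :: "(nat \<Rightarrow> 'a::pointfree_locale set) \<Rightarrow> nat \<Rightarrow> nat \<Rightarrow> bool" where
  "pseudocomplete P i j \<longleftrightarrow> prefit P i j \<and>
     (\<exists>C :: nat \<Rightarrow> 'a set set. (\<forall>n. pi_base P i (C n)) \<and>
       (\<forall>x :: nat \<Rightarrow> 'a.
          (\<forall>n. open_sub (x n) \<in> C n \<and>
               k_closure P j (open_sub (x (Suc n))) \<subseteq> open_sub (x n)) \<longrightarrow>
          (\<Inter>n. open_sub (x n)) \<noteq> void_sublocale))"

end

theory Submission
  imports Defs
begin

text \<open>A dense open sublocale meets every non-void \<open>i\<close>-open one, so the usual nested-interval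
  argument applies. Given a non-zero \<open>x\<^sub>n \<in> L\<^sub>i\<close>, the meet \<open>x\<^sub>n \<and> a\<^sub>n\<close> with the \<open>n\<close>-th dense
  open is non-zero, so prefitness yields a non-zero \<open>y \<in> L\<^sub>i\<close> whose \<open>j\<close>-closure lies in \<open>x\<^sub>n \<and> a\<^sub>n\<close>;
  take for \<open>x\<^sub>n\<^sub>+\<^sub>1\<close> a member of the next \<open>\<pi>\<close>-base below \<open>y\<close>. Pseudocompleteness keeps the
  intersection non-void.\<close>

lemma le_heyting_self: "s \<le> (a \<rightarrow>\<^sub>H s)"
  by (simp add: le_heyting_iff)

lemma heyting_inf_le: "inf (a \<rightarrow>\<^sub>H b) a \<le> b"
  using le_heyting_iff[of "a \<rightarrow>\<^sub>H b" a b] by simp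

text \<open>The map \<open>\<lambda>s. a \<rightarrow>\<^sub>H s\<close> is inflationary and
  idempotent, so its image is its set of fixed points, and one inequality suffices to recognise
  them.\<close>

lemma open_sub_iff: "s \<in> open_sub a \<longleftrightarrow> (a \<rightarrow>\<^sub>H s) \<le> s"
proof
  assume "s \<in> open_sub a"
  then obtain x where s: "s = (a \<rightarrow>\<^sub>H x)"
    unfolding open_sub_def by auto
  have "inf (a \<rightarrow>\<^sub>H s) a \<le> inf s a"
    by (simp add: heyting_inf_le)
  also have "\<dots> \<le> x"
    unfolding s by (rule heyting_inf_le)
  finally show "(a \<rightarrow>\<^sub>H s) \<le> s"
    unfolding s by (simp only: le_heyting_iff)
next
  assume "(a \<rightarrow>\<^sub>H s) \<le> s"
  then have "s = (a \<rightarrow>\<^sub>H s)"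
    by (simp add: le_heyting_self order.antisym)
  then show "s \<in> open_sub a"
    unfolding open_sub_def by blast
qed

lemma heyting_mono: "x \<le> y \<Longrightarrow> (a \<rightarrow>\<^sub>H x) \<le> (a \<rightarrow>\<^sub>H y)"
  by (meson heyting_inf_le le_heyting_iff order_trans)

lemma heyting_antimono: "a \<le> b \<Longrightarrow> (b \<rightarrow>\<^sub>H x) \<le> (a \<rightarrow>\<^sub>H x)"
  by (meson heyting_inf_le inf_mono le_heyting_iff order_refl order_trans)

text \<open>Both sides are implication out of \<open>inf a b\<close>. This is what makes an open
  sublocale stable under \<open>x \<rightarrow>\<^sub>H _\<close>.\<close>

lemma heyting_left_commute: "(a \<rightarrow>\<^sub>H b \<rightarrow>\<^sub>H s) \<le> (b \<rightarrow>\<^sub>H a \<rightarrow>\<^sub>H s)"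
proof -
  have "inf (inf (a \<rightarrow>\<^sub>H b \<rightarrow>\<^sub>H s) a) b \<le> s"
    using heyting_inf_le[of a "b \<rightarrow>\<^sub>H s"] by (simp only: le_heyting_iff)
  then show ?thesis
    by (simp add: le_heyting_iff ac_simps)
qed

lemma open_sub_mono: "a \<le> b \<Longrightarrow> open_sub a \<subseteq> open_sub b"
  unfolding open_sub_iff subset_iff by (blast intro: heyting_antimono order_trans)

lemma top_in_open_sub: "top \<in> open_sub a"
  by (simp add: open_sub_iff)

lemma open_sub_top: "open_sub top = UNIV"
  using heyting_inf_le[of top] by (auto simp: open_sub_iff)

lemma open_sub_eq_void_iff: "open_sub a = void_sublocale \<longleftrightarrow> a = bot"
proof
  assume "open_sub a = void_sublocale"
  then have "(a \<rightarrow>\<^sub>H bot) = top"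
    unfolding void_sublocale_def open_sub_def by blast
  then show "a = bot"
    using heyting_inf_le[of a bot] by (simp add: bot_unique)
next
  assume "a = bot"
  moreover have "(bot \<rightarrow>\<^sub>H x) = top" for x :: 'a
    by (simp add: top_unique[symmetric] le_heyting_iff)
  ultimately show "open_sub a = void_sublocale"
    unfolding void_sublocale_def open_sub_def by auto
qed

lemma is_sublocale_open_sub: "is_sublocale (open_sub a)"
  unfolding is_sublocale_def
proof (intro conjI allI impI ballI)
  fix A assume A: "A \<subseteq> open_sub a"
  have "(a \<rightarrow>\<^sub>H Inf A) \<le> s" if "s \<in> A" for s
    using heyting_mono[OF Inf_lower[OF that], of a] A that
    unfolding open_sub_iff subset_iff by (blast intro: order_trans)
  then show "Inf A \<in> open_sub a"
    by (simp add: open_sub_iff Inf_greatest)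
next
  fix x s assume "s \<in> open_sub a"
  then show "(x \<rightarrow>\<^sub>H s) \<in> open_sub a"
    using heyting_left_commute[of a x s] heyting_mono[of "a \<rightarrow>\<^sub>H s" s x]
    by (simp add: open_sub_iff order_trans)
qed

text \<open>The least element of \<open>open_sub a\<close> is
  \<open>a \<rightarrow>\<^sub>H bot\<close>, so only that element has to be compared with
  \<open>c\<close>.\<close>

lemma open_sub_subset_closed_sub_iff: "open_sub a \<subseteq> closed_sub c \<longleftrightarrow> inf c a = bot"
proof
  assume "open_sub a \<subseteq> closed_sub c"
  then have "c \<le> (a \<rightarrow>\<^sub>H bot)"
    unfolding open_sub_def closed_sub_def by blast
  then show "inf c a = bot"
    by (simp add: le_heyting_iff bot_unique)
next
  assume "inf c a = bot"
  then show "open_sub a \<subseteq> closed_sub c"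
    unfolding open_sub_def closed_sub_def by (auto simp: le_heyting_iff)
qed

text \<open>For \<open>s\<close> above \<open>u\<close>, both \<open>u\<close> and \<open>v\<close>
  lie below \<open>(v \<rightarrow>\<^sub>H s) \<rightarrow>\<^sub>H s\<close>; hence so does their
  join \<open>top\<close>, which makes \<open>s\<close> a fixed point of
  \<open>v \<rightarrow>\<^sub>H _\<close>.\<close>

lemma closed_sub_subset_open_sub:
  assumes "sup u v = top"
  shows "closed_sub u \<subseteq> open_sub v"
proof
  fix s assume "s \<in> closed_sub u"
  then have "u \<le> ((v \<rightarrow>\<^sub>H s) \<rightarrow>\<^sub>H s)"
    unfolding closed_sub_def le_heyting_iff by (simp add: le_infI1)
  moreover have "v \<le> ((v \<rightarrow>\<^sub>H s) \<rightarrow>\<^sub>H s)"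
    using heyting_inf_le[of v s] by (simp add: le_heyting_iff inf_commute)
  ultimately have "top \<le> ((v \<rightarrow>\<^sub>H s) \<rightarrow>\<^sub>H s)"
    unfolding assms[symmetric] by simp
  then show "s \<in> open_sub v"
    by (simp add: le_heyting_iff open_sub_iff)
qed

lemma subset_k_closure: "S \<subseteq> k_closure P k S"
  unfolding k_closure_def by blast

text \<open>The closure is everything exactly when it contains \<open>bot\<close>, and
  \<open>bot\<close> belongs to \<open>closed_sub c\<close> only for \<open>c = bot\<close>.\<close>

lemma k_dense_iff: "k_dense P k S \<longleftrightarrow> (\<forall>c\<in>P k. S \<subseteq> closed_sub c \<longrightarrow> c = bot)"
proof
  assume "k_dense P k S"
  then have "bot \<in> k_closure P k S"
    by (simp add: k_dense_def)
  then have "bot \<in> closed_sub c" if "c \<in> P k" "S \<subseteq> closed_sub c" for c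
    using that unfolding k_closure_def by blast
  then show "\<forall>c\<in>P k. S \<subseteq> closed_sub c \<longrightarrow> c = bot"
    by (simp add: closed_sub_def bot_unique)
next
  assume "\<forall>c\<in>P k. S \<subseteq> closed_sub c \<longrightarrow> c = bot"
  then show "k_dense P k S"
    unfolding k_dense_def k_closure_def by (auto simp: closed_sub_def)
qed

lemma inf_bullet: "inf (bullet P j y) y = bot"
proof -
  have "inf y (bullet P j y) \<le> bot"
    unfolding bullet_def inf_Sup_frame by (auto intro!: Sup_least simp: inf_commute)
  then show ?thesis
    by (simp add: bot_unique inf_commute)
qed

text \<open>This turns the algebraic prefitness condition into containment of a closure:
  \<open>bullet P j y\<close> is a join of elements of \<open>P j\<close> and is disjoint from
  \<open>y\<close>, so \<open>closed_sub (bullet P j y)\<close> takes part in the intersection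
  defining the closure.\<close>

lemma k_closure_subset_open_sub:
  assumes "subframe (P j)" and "sup (bullet P j y) x = top" and "S \<subseteq> open_sub y"
  shows "k_closure P j S \<subseteq> open_sub x"
proof -
  have "bullet P j y \<in> P j"
    using assms(1) by (simp add: subframe_def bullet_def)
  moreover have "S \<subseteq> closed_sub (bullet P j y)"
    using assms(3) inf_bullet open_sub_subset_closed_sub_iff by blast
  ultimately have "k_closure P j S \<subseteq> closed_sub (bullet P j y)"
    unfolding k_closure_def by blast
  also have "\<dots> \<subseteq> open_sub x"
    by (rule closed_sub_subset_open_sub[OF assms(2)])
  finally show ?thesis .
qed

lemma pi_base_below:
  assumes "pi_base P i C" and "c \<in> P i" and "c \<noteq> bot"
  obtains x where "x \<in> P i" "x \<noteq> bot" "open_sub x \<in> C" "open_sub x \<subseteq> open_sub c"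
proof -
  have "k_open P i (open_sub c)" "open_sub c \<noteq> void_sublocale"
    using assms(2,3) by (auto simp: k_open_def is_sublocale_open_sub open_sub_eq_void_iff)
  then obtain U where U: "U \<in> C" "U \<subseteq> open_sub c"
    using assms(1) unfolding pi_base_def by blast
  have "k_open P i U" and ne: "U \<noteq> void_sublocale"
    using assms(1) U(1) unfolding pi_base_def by simp_all
  then obtain x where "x \<in> P i" "U = open_sub x"
    unfolding k_open_def by blast
  then show thesis
    using that U ne by (simp add: open_sub_eq_void_iff)
qed

text \<open>The element \<open>s\<close> witnesses that the intersection of the dense opens meets
  \<open>open_sub c\<close> in more than the void sublocale.\<close>

lemma pseudocomplete_dense_sequence_meets:
  fixes a :: "nat \<Rightarrow> 'a::pointfree_locale"
  assumes "subframe (P j)" and "pseudocomplete P i j"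
    and dense: "\<And>n. k_dense P i (open_sub (a n))"
    and "c \<in> P i" and "c \<noteq> bot"
  shows "\<exists>s. s \<noteq> top \<and> s \<in> open_sub c \<and> (\<forall>n. s \<in> open_sub (a n))"
proof -
  have prefit: "prefit P i j"
    using assms(2) by (simp add: pseudocomplete_def)
  obtain C where base: "\<And>n. pi_base P i (C n)"
    and complete: "\<And>x. (\<And>n. open_sub (x n) \<in> C n \<and>
      k_closure P j (open_sub (x (Suc n))) \<subseteq> open_sub (x n)) \<Longrightarrow>
      (\<Inter>n. open_sub (x n)) \<noteq> void_sublocale"
    using assms(2) unfolding pseudocomplete_def by blast
  \<comment> \<open>The clause for \<open>n = 0\<close> starts the recursion inside
    \<open>open_sub c\<close>; at successor stages it is vacuous.\<close>
  have "\<exists>x. \<forall>n. (x n \<in> P i \<and> x n \<noteq> bot \<and> open_sub (x n) \<in> C n \<and>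
      (n = 0 \<longrightarrow> open_sub (x n) \<subseteq> open_sub c)) \<and>
      k_closure P j (open_sub (x (Suc n))) \<subseteq> open_sub (inf (x n) (a n))"
  proof (rule dependent_nat_choice)
    show "\<exists>x. x \<in> P i \<and> x \<noteq> bot \<and> open_sub x \<in> C 0 \<and>
        (0 = (0::nat) \<longrightarrow> open_sub x \<subseteq> open_sub c)"
      using pi_base_below[OF base assms(4,5)] by blast
  next
    fix x n
    assume x: "x \<in> P i \<and> x \<noteq> bot \<and> open_sub x \<in> C n \<and>
        (n = 0 \<longrightarrow> open_sub x \<subseteq> open_sub c)"
    \<comment> \<open>Otherwise \<open>open_sub (a n)\<close> would lie in
      \<open>closed_sub x\<close>, and density would force \<open>x = bot\<close>.\<close>
    have "inf x (a n) \<noteq> bot"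
      using x dense[of n] by (auto simp: k_dense_iff open_sub_subset_closed_sub_iff)
    then obtain y where y: "y \<in> P i" "y \<noteq> bot" "sup (bullet P j y) (inf x (a n)) = top"
      using prefit unfolding prefit_def by blast
    obtain z where "z \<in> P i" "z \<noteq> bot" "open_sub z \<in> C (Suc n)" "open_sub z \<subseteq> open_sub y"
      using pi_base_below[OF base y(1,2)] by blast
    then show "\<exists>z. (z \<in> P i \<and> z \<noteq> bot \<and> open_sub z \<in> C (Suc n) \<and>
        (Suc n = 0 \<longrightarrow> open_sub z \<subseteq> open_sub c)) \<and>
        k_closure P j (open_sub z) \<subseteq> open_sub (inf x (a n))"
      using k_closure_subset_open_sub[OF assms(1) y(3)] by blast
  qed
  then obtain x where x0: "open_sub (x 0) \<subseteq> open_sub c"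
    and xC: "\<And>n. open_sub (x n) \<in> C n"
    and xcl: "\<And>n. k_closure P j (open_sub (x (Suc n))) \<subseteq> open_sub (inf (x n) (a n))"
    by blast
  have "k_closure P j (open_sub (x (Suc n))) \<subseteq> open_sub (x n)" for n
    using xcl[of n] open_sub_mono[OF inf_le1] by (rule order_trans)
  then have "(\<Inter>n. open_sub (x n)) \<noteq> void_sublocale"
    using complete xC by simp
  moreover have "top \<in> (\<Inter>n. open_sub (x n))"
    by (simp add: top_in_open_sub)
  ultimately obtain s where "s \<noteq> top" and s: "\<And>n. s \<in> open_sub (x n)"
    unfolding void_sublocale_def by blast
  \<comment> \<open>The index shifts by one: membership of \<open>s\<close> in stage
    \<open>Suc n\<close> yields membership in the \<open>n\<close>-th dense open.\<close>
  moreover have "s \<in> open_sub (a n)" for n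
  proof -
    have "s \<in> k_closure P j (open_sub (x (Suc n)))"
      using s subset_k_closure by (rule rev_subsetD)
    then show ?thesis
      using xcl[of n] open_sub_mono[OF inf_le2] by blast
  qed
  ultimately show ?thesis
    using x0 by blast
qed

theorem proposition2p16:
  fixes P :: "nat \<Rightarrow> 'a::pointfree_locale set" and i j :: nat
  assumes "{i, j} = {1, 2}"
    and "bilocale P"
    and "pseudocomplete P i j"
  shows "Baire P i j"
  unfolding Baire_def
proof (intro allI impI)
  fix F :: "'a set set"
  assume F: "countable F \<and> (\<forall>S\<in>F. k_open P j S \<and> k_dense P i S)"
  have "j = 1 \<or> j = 2"
    using assms(1) by auto
  then have sub: "subframe (P j)"
    using assms(2) by (auto simp: bilocale_def)
  \<comment> \<open>Adjoining the whole locale makes the family non-empty, hence the range of a sequence.\<close>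
  define G where "G = insert UNIV F"
  have "k_dense P i (UNIV :: 'a set)"
    using subset_k_closure by (auto simp: k_dense_def)
  then have G: "\<exists>a. S = open_sub a \<and> k_dense P i S" if "S \<in> G" for S
    using F that open_sub_top unfolding G_def k_open_def by blast
  have range: "range (from_nat_into G) = G"
    using F by (intro range_from_nat_into) (auto simp: G_def)
  then have "\<exists>a. from_nat_into G n = open_sub a \<and> k_dense P i (open_sub a)" for n
    using G by (metis rangeI)
  then obtain a where a: "\<And>n. from_nat_into G n = open_sub (a n)"
    and dense: "\<And>n. k_dense P i (open_sub (a n))"
    by metis
  \<comment> \<open>The adjoined \<open>UNIV\<close> does not change the intersection.\<close>
  have F_a: "\<Inter> F = (\<Inter>n. open_sub (a n))"
    using arg_cong[OF range, of Inter] by (simp add: a[symmetric] G_def)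
  show "k_dense P i (\<Inter> F)"
    unfolding k_dense_iff
  proof (intro ballI impI, rule ccontr)
    fix c assume c: "c \<in> P i" "\<Inter> F \<subseteq> closed_sub c" "c \<noteq> bot"
    obtain s where "s \<noteq> top" "s \<in> open_sub c" "\<And>n. s \<in> open_sub (a n)"
      using pseudocomplete_dense_sequence_meets[where a = a, OF sub assms(3) dense c(1,3)]
      by blast
    \<comment> \<open>\<open>open_sub c\<close> and \<open>closed_sub c\<close> share only
      \<open>top\<close>: membership in the first gives
      \<open>(c \<rightarrow>\<^sub>H s) \<le> s\<close>, while \<open>c \<le> s\<close> makes the
      implication \<open>top\<close>.\<close>
    then have "(c \<rightarrow>\<^sub>H s) \<noteq> top"
      by (auto simp: open_sub_iff top_unique)
    moreover have "c \<le> s"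
      using c(2) \<open>\<And>n. s \<in> open_sub (a n)\<close> unfolding F_a closed_sub_def by blast
    ultimately show False
      using le_heyting_iff[of top c s] by (simp add: top_unique)
  qed
qed

end
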